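(* Let $E$ be the figure-eight knot. If $a$ is a complex number with $|2\cosh a-2|<1$ and $|\operatorname{Im} a|<\pi/3$, then the sequence $\{J_N(E;\exp(a/N))\}_{N=2,3,\dots}$ converges and $$\lim_{N\to\infty}J_N\left(E;\exp\frac{a}{N}\right)=\frac{1}{\Delta(E;\exp a)},$$ where $\Delta(E;t)=-t+3-t^{-1}$ is the Alexander polynomial of $E$.
   Context: For a knot $K$, $J_N(K;t)$ denotes the colored Jones polynomial of $K$ corresponding to the $N$-dimensional irreducible representation of $sl_2(\mathbb{C})$, normalized so that $J_N(U;t)=1$ for the unknot $U$. For the figure-eight knot $E$ it is given by the known formula of Habiro and Le, which may be taken as the definition here: $$J_N(E;t)=\sum_{k=0}^{N-1}\prod_{j=1}^{k}\left(t^{(N+j)/2}-t^{-(N+j)/2}\right)\left(t^{(N-j)/2}-t^{-(N-j)/2}\right),$$ where the empty product (for $k=0$) is $1$. At $t=\exp(a/N)$ this reads $$J_N\left(E;\exp\frac{a}{N}\right)=\sum_{k=0}^{N-1}\prod_{j=1}^{k}\left(2\cosh a-2\cosh\frac{aj}{N}\right).$$ *)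

theory Defs
  imports "HOL-Analysis.Complex_Transcendental"
begin

text \<open>
  The \<open>N\<close>-dimensional colored Jones polynomial of the figure-eight knot, normalized to be 1 on
  the unknot, given by the formula of Habiro and Le and viewed as a function of a nonzero complex
  number \<open>t\<close>.  The half-integral powers use the principal logarithm of \<open>t\<close>; this choice is
  immaterial, since the other square root of \<open>t\<close> changes both factors of the product by the same
  sign, and each such product equals \<open>t^N + t^(-N) - t^j - t^(-j)\<close>.
\<close>
definition colored_jones_fig8 :: "nat \<Rightarrow> complex \<Rightarrow> complex" where
  "colored_jones_fig8 N t =
     (\<Sum>k<N. \<Prod>j=1..k.
        (t powr ((of_nat N + of_nat j) / 2) - t powr (- ((of_nat N + of_nat j) / 2))) *
        (t powr ((of_nat N - of_nat j) / 2) - t powr (- ((of_nat N - of_nat j) / 2))))"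

definition alexander_fig8 :: "complex \<Rightarrow> complex" where
  "alexander_fig8 t = - t + 3 - inverse t"

end

theory Submission
  imports Defs
begin

text \<open>
  The factors of the sum are \<open>2 * cosh a - 2 * cosh (s * a)\<close> with \<open>s = j / N\<close>, and for fixed
  \<open>j\<close> they tend to \<open>q = 2 * cosh a - 2\<close>, so that the sum formally tends to the geometric series
  \<open>1 / (1 - q) = 1 / (3 - 2 * cosh a)\<close>.  Tannery's theorem makes this rigorous as soon as all the
  factors are bounded by \<open>norm q < 1\<close>, uniformly in \<open>0 \<le> s \<le> 1\<close>.  The two hypotheses force
  \<open>norm a \<le> 2\<close>, and in this disc the power series of \<open>cosh\<close> shows that
  \<open>cosh (s * a) - 1\<close> differs from \<open>s\<^sup>2 * (cosh a - 1)\<close> by at most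
  \<open>s\<^sup>2 * (1 - s\<^sup>2) * norm (cosh a - 1)\<close>, whence the factor is at most \<open>(1 - s^4) * norm q\<close>.
\<close>

section \<open>Power series estimates for \<open>sinh\<close> and \<open>cosh\<close>\<close>

text \<open>Each odd power satisfies \<open>r ^ n \<le> r / 2 * 2 ^ n\<close>, so the series gives
  \<open>sinh r \<le> r / 2 * sinh 2\<close>; and \<open>sinh 2 \<le> 4\<close> because
  \<open>exp 2 < 2.72^2 < 8\<close>.\<close>

lemma sinh_le_double:
  fixes r :: real
  assumes "0 \<le> r" "r \<le> 2"
  shows "sinh r \<le> 2 * r"
proof -
  have e: "exp 2 \<le> (8::real)"
  proof -
    have "exp 2 = exp (1::real) ^ 2"
      by (simp flip: exp_of_nat_mult)
    also have "\<dots> \<le> (272/100) ^ 2"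
      by (intro power_mono) (use e_less_272 in auto)
    finally show ?thesis by (simp add: power2_eq_square)
  qed
  have s2: "sinh 2 \<le> (4::real)"
  proof -
    have "exp 2 - exp (- 2) \<le> (8::real)"
      using e by (rule order_trans[rotated]) simp
    then show ?thesis by (simp add: sinh_field_def)
  qed
  have "(\<lambda>n. r / 2 * (if even n then 0 else 2 ^ n /\<^sub>R fact n)) sums (r / 2 * sinh 2)"
    by (intro sums_mult sinh_converges)
  then have "sinh r \<le> r / 2 * sinh 2"
  proof (rule sums_le[OF _ sinh_converges, rotated])
    fix n
    have "r ^ n \<le> r / 2 * 2 ^ n" if n: "odd n"
    proof -
      obtain m where m: "n = Suc m" using n by (cases n) auto
      have "r ^ m \<le> 2 ^ m" using assms by (intro power_mono) auto
      then show ?thesis using assms unfolding m by (simp add: mult_left_mono)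
    qed
    then show "(if even n then 0 else r ^ n /\<^sub>R fact n)
        \<le> r / 2 * (if even n then 0 else 2 ^ n /\<^sub>R fact n)"
      by (auto simp: field_simps)
  qed
  also have "\<dots> \<le> r / 2 * 4"
    using s2 assms by (intro mult_left_mono) auto
  finally show ?thesis by simp
qed

lemma norm_sums_le_sums:
  fixes f :: "nat \<Rightarrow> 'a :: banach"
  assumes "f sums x" "g sums y" "\<And>n. norm (f n) \<le> g n"
  shows "norm x \<le> y"
  using assms norm_suminf_le[of f g] by (auto simp: sums_iff)

text \<open>Kept general in the field because it is applied both to a complex number and to its real
  norm, where the second series dominates the first term by term.\<close>

lemma cosh_minus_quadratic_sums:
  fixes z :: "'a :: {banach, real_normed_field}"
  shows "(\<lambda>n. if even n \<and> n \<ge> 4 then z ^ n /\<^sub>R fact n else 0) sums (cosh z - (1 + z\<^sup>2 / 2))"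
proof -
  have "(\<lambda>n. if n \<in> {0,2} then z ^ n /\<^sub>R fact n else 0) sums (\<Sum>n\<in>{0,2}. z ^ n /\<^sub>R fact n)"
    by (intro sums_If_finite_set) simp
  also have "(\<Sum>n\<in>{0,2}. z ^ n /\<^sub>R fact n) = 1 + z\<^sup>2 / 2"
    by (simp add: scaleR_conv_of_real field_simps)
  finally have "(\<lambda>n. (if even n then z ^ n /\<^sub>R fact n else 0) -
      (if n \<in> {0,2} then z ^ n /\<^sub>R fact n else 0)) sums (cosh z - (1 + z\<^sup>2 / 2))"
    by (intro sums_diff cosh_converges)
  also have "(\<lambda>n. (if even n then z ^ n /\<^sub>R fact n else 0) -
      (if n \<in> {0,2} then z ^ n /\<^sub>R fact n else 0)) =
      (\<lambda>n. if even n \<and> n \<ge> 4 then z ^ n /\<^sub>R fact n else 0)"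
  proof
    fix n :: nat
    have "n \<in> {0,2} \<longleftrightarrow> even n \<and> \<not> n \<ge> 4" 
      by (auto elim!: evenE)
    then show "(if even n then z ^ n /\<^sub>R fact n else 0) -
        (if n \<in> {0,2} then z ^ n /\<^sub>R fact n else 0) =
        (if even n \<and> n \<ge> 4 then z ^ n /\<^sub>R fact n else 0)" by auto
  qed
  finally show ?thesis .
qed

text \<open>With \<open>r = norm a\<close>, the term \<open>a^2 / 2\<close> has norm
  \<open>r^2 / 2\<close>, and the tail of the series of \<open>cosh a\<close> costs at most
  \<open>cosh r - 1 - r^2 / 2\<close>; the left side is the difference of the two.\<close>

lemma norm_cosh_minus_1_ge:
  fixes a :: complex
  shows "(norm a)\<^sup>2 + 1 - cosh (norm a) \<le> norm (cosh a - 1)"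
proof -
  have "norm (cosh a - (1 + a\<^sup>2 / 2)) \<le> cosh (norm a) - (1 + (norm a)\<^sup>2 / 2)"
    by (rule norm_sums_le_sums[OF cosh_minus_quadratic_sums cosh_minus_quadratic_sums])
      (auto simp: norm_power)
  moreover have "norm (a\<^sup>2 / 2) - norm (cosh a - (1 + a\<^sup>2 / 2)) \<le> norm (cosh a - 1)"
    using norm_triangle_ineq4[of "cosh a - 1" "cosh a - (1 + a\<^sup>2 / 2)"] by simp
  ultimately show ?thesis
    by (simp add: norm_divide norm_power)
qed

text \<open>The coefficients of \<open>a ^ n\<close> on the left, for even \<open>n > 0\<close>, are
  \<open>(s^2 - s^n) / fact n\<close>. Bernoulli's inequality extracts the factor
  \<open>s^2 * (1 - s^2)\<close> from each, leaving a real series in \<open>norm a\<close> that sums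
  to something below \<open>norm (cosh a - 1)\<close>.\<close>

lemma norm_cosh_scaled_deviation_le:
  fixes a :: complex and s :: real
  assumes s: "0 \<le> s" "s \<le> 1" and a: "norm a \<le> 2"
  shows "norm (s\<^sup>2 * (cosh a - 1) - (cosh (s * a) - 1)) \<le> s\<^sup>2 * (1 - s\<^sup>2) * norm (cosh a - 1)"
proof -
  define r where "r = norm a"
  have r: "0 \<le> r" "r \<le> 2" using a by (auto simp: r_def)
  define d where "d n = s\<^sup>2 * (if even n then a ^ n /\<^sub>R fact n else 0)
     - (if even n then (s * a) ^ n /\<^sub>R fact n else 0) - (if n \<in> {0} then s\<^sup>2 - 1 else 0)" for n
  \<comment> \<open>For even \<open>n > 0\<close> this is
    \<open>(n / 2 - 1) * r ^ n / fact n\<close>; the last summand cancels the value -1 at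
    \<open>n = 0\<close>, just as the last one in \<open>d\<close> makes
    \<open>d 0 = 0\<close>.\<close>
  define g where "g n = (if even n then (real n / 2) * r ^ n / fact n else 0)
     - (if even n then r ^ n /\<^sub>R fact n else 0) + (if n \<in> {0} then 1 else 0)" for n
  have "d sums (s\<^sup>2 * cosh a - cosh (s * a) - of_real (s\<^sup>2 - 1))"
    unfolding d_def using sums_If_finite_set[of "{0}" "\<lambda>_. of_real (s\<^sup>2 - 1) :: complex"]
    by (intro sums_diff sums_mult cosh_converges) (simp add: if_distrib cong: if_cong)
  then have d: "d sums (s\<^sup>2 * (cosh a - 1) - (cosh (s * a) - 1))"
    by (simp add: algebra_simps)
  \<comment> \<open>Since \<open>n / fact n = 1 / fact (n - 1)\<close>, this series is the one of
    \<open>sinh\<close> shifted by one index; its term at 0 vanishes, so the shift leaves the sum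
    unchanged.\<close>
  have "(\<lambda>n. if even (Suc n) then (real (Suc n) / 2) * r ^ Suc n / fact (Suc n) else 0)
      = (\<lambda>n. r / 2 * (if even n then 0 else r ^ n /\<^sub>R fact n))"
    by (rule ext) (simp add: field_simps del: of_nat_Suc)
  then have "(\<lambda>n. if even (Suc n) then (real (Suc n) / 2) * r ^ Suc n / fact (Suc n) else 0)
      sums (r / 2 * sinh r)"
    using sums_mult[OF sinh_converges[of r], of "r / 2"] by simp
  then have "(\<lambda>n. if even n then (real n / 2) * r ^ n / fact n else 0) sums (r / 2 * sinh r)"
    by (subst (asm) sums_Suc_iff) simp
  then have g: "g sums (r / 2 * sinh r - cosh r + 1)"
    unfolding g_def using sums_If_finite_set[of "{0}" "\<lambda>_. 1 :: real"]
    by (intro sums_add sums_diff cosh_converges) simp_all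
  have "norm (d n) \<le> s\<^sup>2 * (1 - s\<^sup>2) * g n" for n
  proof (cases "even n \<and> n > 0")
    case False
    then show ?thesis by (auto simp: d_def g_def)
  next
    case True
    then obtain k where n: "n = 2 * Suc k"
      by (metis dvdE gr0_implies_Suc mult_0_right not_gr0)
    define q where "q = s\<^sup>2"
    have q: "0 \<le> q" "q \<le> 1" using s by (auto simp: q_def power_le_one)
    \<comment> \<open>Bernoulli at \<open>q - 1\<close> reads
      \<open>1 - q ^ k \<le> k * (1 - q)\<close>, where \<open>k = n / 2 - 1\<close> is the weight
      occurring in \<open>g\<close>.\<close>
    have "1 + real k * (q - 1) \<le> (1 + (q - 1)) ^ k"
      using q by (intro Bernoulli_inequality) auto
    then have "q * (1 - q ^ k) \<le> q * (real k * (1 - q))"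
      using q by (intro mult_left_mono) (auto simp: algebra_simps)
    then have 1: "q - q ^ Suc k \<le> q * (1 - q) * real k"
      by (simp add: algebra_simps)
    have 2: "0 \<le> q - q ^ Suc k"
      using power_decreasing[of 1 "Suc k" q] q by simp
    have sn: "s ^ n = q ^ Suc k"
      unfolding n q_def by (simp only: power_mult)
    have "d n = of_real ((q - s ^ n) / fact n) * a ^ n"
      using True by (simp add: d_def q_def scaleR_conv_of_real field_simps power_mult_distrib)
    then have "norm (d n) = (q - q ^ Suc k) / fact n * r ^ n"
      using 2 unfolding sn by (simp only: norm_mult norm_of_real norm_power r_def) simp
    also have "\<dots> \<le> (q * (1 - q) * real k) / fact n * r ^ n"
      using 1 r by (intro mult_right_mono divide_right_mono) auto
    also have "\<dots> = q * (1 - q) * g n"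
      using True unfolding g_def by (simp add: n field_simps del: fact_Suc power_Suc)
    finally show ?thesis by (simp add: q_def)
  qed
  then have "norm (s\<^sup>2 * (cosh a - 1) - (cosh (s * a) - 1))
      \<le> s\<^sup>2 * (1 - s\<^sup>2) * (r / 2 * sinh r - cosh r + 1)"
    by (intro norm_sums_le_sums[OF d sums_mult[OF g]])
  also have "\<dots> \<le> s\<^sup>2 * (1 - s\<^sup>2) * norm (cosh a - 1)"
  proof (intro mult_left_mono)
    \<comment> \<open>Here \<open>r \<le> 2\<close> enters: \<open>r / 2 * sinh r \<le> r^2\<close>
      turns the sum of \<open>g\<close> into the lower bound for
      \<open>norm (cosh a - 1)\<close>.\<close>
    have "r / 2 * sinh r \<le> r / 2 * (2 * r)"
      using r sinh_le_double[of r] by (intro mult_left_mono) auto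
    then show "r / 2 * sinh r - cosh r + 1 \<le> norm (cosh a - 1)"
      using norm_cosh_minus_1_ge[of a] by (simp add: r_def power2_eq_square)
    show "0 \<le> s\<^sup>2 * (1 - s\<^sup>2)"
      using s by (simp add: power_le_one)
  qed
  finally show ?thesis .
qed

lemma norm_cosh_diff_scaled_le:
  fixes a :: complex and s :: real
  assumes s: "0 \<le> s" "s \<le> 1" and a: "norm a \<le> 2"
  shows "norm (cosh a - cosh (s * a)) \<le> norm (cosh a - 1)"
proof -
  have s2: "0 \<le> s\<^sup>2" "s\<^sup>2 \<le> 1" using s by (auto simp: power_le_one)
  have "cosh a - cosh (s * a) =
      of_real (1 - s\<^sup>2) * (cosh a - 1) + (s\<^sup>2 * (cosh a - 1) - (cosh (s * a) - 1))"
    by (simp add: algebra_simps)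
  also have "norm \<dots> \<le> (1 - s\<^sup>2) * norm (cosh a - 1) + s\<^sup>2 * (1 - s\<^sup>2) * norm (cosh a - 1)"
    using s2 by (intro norm_triangle_le add_mono norm_cosh_scaled_deviation_le assms)
      (simp only: norm_mult norm_of_real)
  also have "\<dots> = (1 - s\<^sup>2 * s\<^sup>2) * norm (cosh a - 1)"
    by (simp add: algebra_simps)
  also have "\<dots> \<le> 1 * norm (cosh a - 1)"
    using s2 by (intro mult_right_mono) auto
  finally show ?thesis by simp
qed

section \<open>Confining \<open>a\<close> to the disc of radius 2\<close>

lemma Re_cosh_complex: "Re (cosh z) = cosh (Re z) * cos (Im z)"
  by (simp add: cosh_field_def Re_exp field_simps)

lemma Im_cosh_complex: "Im (cosh z) = sinh (Re z) * sin (Im z)"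
  by (simp add: cosh_field_def sinh_field_def Im_exp field_simps)

lemma norm_cosh_squared:
  "(norm (cosh z))\<^sup>2 = (sinh (Re z))\<^sup>2 + (cos (Im z))\<^sup>2"
proof -
  have "(norm (cosh z))\<^sup>2 = (cosh (Re z) * cos (Im z))\<^sup>2 + (sinh (Re z) * sin (Im z))\<^sup>2"
    unfolding cmod_power2 Re_cosh_complex Im_cosh_complex ..
  also have "\<dots> = (1 + (sinh (Re z))\<^sup>2) * (cos (Im z))\<^sup>2 + (sinh (Re z))\<^sup>2 * (1 - (cos (Im z))\<^sup>2)"
    by (simp add: power_mult_distrib cosh_square_eq sin_squared_eq)
  finally show ?thesis by (simp add: algebra_simps)
qed

text \<open>The first hypothesis gives \<open>norm (cosh a) < 3/2\<close>, the second
  \<open>cos (Im a) \<ge> 1/2\<close>. Hence \<open>(sinh (Re a))^2 \<le> 9/4 - 1/4 = 2\<close>,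
  which also bounds \<open>(Re a)^2\<close>.\<close>

lemma norm_le_2_if_norm_cosh_lt:
  assumes "norm (2 * cosh a - 2) < 1" and "\<bar>Im a\<bar> < pi / 3"
  shows "norm a \<le> 2"
proof -
  have "norm (2 * cosh a) < 3"
    using norm_triangle_ineq[of "2 * cosh a - 2" 2] assms(1) by simp
  then have "(norm (cosh a))\<^sup>2 \<le> (3/2)\<^sup>2"
    by (intro power_mono) (auto simp: norm_mult)
  moreover have "1/4 \<le> (cos (Im a))\<^sup>2"
  proof -
    have "cos (pi / 3) \<le> cos \<bar>Im a\<bar>"
      using assms(2) by (intro cos_monotone_0_pi_le) auto
    then have "1/2 \<le> cos (Im a)" by (simp add: cos_60)
    then have "(1/2)\<^sup>2 \<le> (cos (Im a))\<^sup>2" by (intro power_mono) auto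
    then show ?thesis by (simp add: power2_eq_square)
  qed
  ultimately have "(sinh (Re a))\<^sup>2 \<le> 2"
    using norm_cosh_squared[of a] by (simp add: power2_eq_square)
  moreover have "(Re a)\<^sup>2 \<le> (sinh (Re a))\<^sup>2"
    using real_le_abs_sinh[of "Re a"] 
    by (simp add: abs_le_square_iff[symmetric] sinh_field_def exp_minus)
  moreover have "(Im a)\<^sup>2 \<le> (4/3)\<^sup>2"
    using assms(2) pi_less_4 by (subst abs_le_square_iff[symmetric]) auto
  \<comment> \<open>The two parts contribute at most \<open>2 + 16/9 < 4\<close>.\<close>
  ultimately have "(norm a)\<^sup>2 \<le> 2\<^sup>2"
    unfolding cmod_power2 by (simp add: power2_eq_square)
  then show ?thesis by (rule power2_le_imp_le) simp
qed

section \<open>The colored Jones polynomial in terms of \<open>cosh\<close>\<close>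

lemma exp_diff_mult_exp_diff:
  fixes u v :: complex
  shows "(exp u - exp (- u)) * (exp v - exp (- v)) = 2 * cosh (u + v) - 2 * cosh (u - v)"
  by (simp add: cosh_field_def algebra_simps flip: exp_add)

lemma colored_jones_fig8_exp:
  assumes "N > 0" "\<bar>Im a\<bar> < pi"
  shows "colored_jones_fig8 N (exp (a / of_nat N)) =
    (\<Sum>k<N. \<Prod>j=1..k. 2 * cosh a - 2 * cosh (of_real (real j / real N) * a))"
proof -
  \<comment> \<open>Keeping the imaginary part strictly between \<open>-pi\<close> and
    \<open>pi\<close> makes the principal logarithm return exactly \<open>a / N\<close>.\<close>
  have "\<bar>Im a\<bar> / real N \<le> \<bar>Im a\<bar> / 1"
    using assms by (intro divide_left_mono) auto
  then have "\<bar>Im (a / of_nat N)\<bar> < pi" using assms by simp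
  then have Ln: "Ln (exp (a / of_nat N)) = a / of_nat N"
    by (intro Ln_exp) linarith+
  have powr: "exp (a / of_nat N) powr z = exp (z * (a / of_nat N))" for z
    by (simp add: powr_def Ln)
  have "(exp (a / of_nat N) powr ((of_nat N + of_nat j) / 2)
        - exp (a / of_nat N) powr (- ((of_nat N + of_nat j) / 2))) *
      (exp (a / of_nat N) powr ((of_nat N - of_nat j) / 2)
        - exp (a / of_nat N) powr (- ((of_nat N - of_nat j) / 2))) =
      2 * cosh a - 2 * cosh (of_real (real j / real N) * a)" for j
  proof -
    have 1: "(of_nat N + of_nat j) / 2 * (a / of_nat N) + (of_nat N - of_nat j) / 2 * (a / of_nat N) = a"
      and 2: "(of_nat N + of_nat j) / 2 * (a / of_nat N) - (of_nat N - of_nat j) / 2 * (a / of_nat N)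
        = of_real (real j / real N) * a"
      using assms by (simp_all add: field_simps)
    show ?thesis
      unfolding powr mult_minus_left exp_diff_mult_exp_diff 1 2 ..
  qed
  then show ?thesis by (simp add: colored_jones_fig8_def)
qed

section \<open>Passage to the limit\<close>

theorem theorem1p1:
  fixes a :: complex
  assumes "norm (2 * cosh a - 2) < 1"
    and "\<bar>Im a\<bar> < pi / 3"
  shows "(\<lambda>N::nat. colored_jones_fig8 N (exp (a / of_nat N)))
           \<longlonglongrightarrow> 1 / alexander_fig8 (exp a)"
proof -
  define q where "q = 2 * cosh a - 2"
  \<comment> \<open>Padding with zeros turns the sums of varying length \<open>N\<close> into series
    over all \<open>k\<close>, the form required by Tannery's theorem.\<close>
  define p where "p k N = (if k < N
    then \<Prod>j=1..k. 2 * cosh a - 2 * cosh (of_real (real j / real N) * a) else 0)" for k N :: nat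
  have a: "norm a \<le> 2" by (rule norm_le_2_if_norm_cosh_lt[OF assms])
  have factor: "norm (2 * cosh a - 2 * cosh (of_real s * a)) \<le> norm q"
    if "0 \<le> s" "s \<le> 1" for s :: real
    using norm_cosh_diff_scaled_le[OF that a] norm_mult[of 2 "cosh a - cosh (of_real s * a)"]
      norm_mult[of 2 "cosh a - 1"]
    by (simp add: q_def right_diff_distrib)
  have bound: "norm (p k N) \<le> norm q ^ k" for k N
  proof (cases "k < N")
    case True
    have "norm (p k N)
        = (\<Prod>j=1..k. norm (2 * cosh a - 2 * cosh (of_real (real j / real N) * a)))"
      using True by (simp add: p_def prod_norm)
    also have "\<dots> \<le> (\<Prod>j=1..k. norm q)"
      using True by (intro prod_mono conjI norm_ge_zero factor) auto
    finally show ?thesis by simp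
  qed (simp add: p_def)
  have limit: "p k \<longlonglongrightarrow> q ^ k" for k
  proof -
    \<comment> \<open>With \<open>k\<close> fixed, the product has a fixed number of factors and
      each \<open>j / N\<close> tends to 0; the padding is no longer felt once
      \<open>N > k\<close>.\<close>
    have "(\<lambda>N. \<Prod>j=1..k. 2 * cosh a - 2 * cosh (of_real (real j / real N) * a))
        \<longlonglongrightarrow> (\<Prod>j=1..k. 2 * cosh a - 2 * cosh (of_real 0 * a))"
      by (intro tendsto_intros lim_const_over_n)
    moreover have "\<forall>\<^sub>F N in sequentially.
        (\<Prod>j=1..k. 2 * cosh a - 2 * cosh (of_real (real j / real N) * a)) = p k N"
      using eventually_gt_at_top[of k] by eventually_elim (simp add: p_def)
    ultimately show ?thesis
      by (simp add: q_def Lim_transform_eventually)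
  qed
  have "(\<lambda>N. \<Sum>k. p k N) \<longlonglongrightarrow> (\<Sum>k. q ^ k)"
    by (rule tannerys_theorem[where M = "\<lambda>k. norm q ^ k", THEN conjunct2, THEN conjunct2])
      (use limit bound assms(1) in
        \<open>simp_all add: q_def summable_geometric case_prod_unfold always_eventually\<close>)
  moreover have "(\<Sum>k. q ^ k) = 1 / alexander_fig8 (exp a)"
    using assms(1) suminf_geometric[of q]
    by (simp add: q_def alexander_fig8_def cosh_field_def exp_minus algebra_simps)
  moreover have "\<forall>\<^sub>F N in sequentially.
      (\<Sum>k. p k N) = colored_jones_fig8 N (exp (a / of_nat N))"
    using eventually_gt_at_top[of 0]
  proof eventually_elim
    case (elim N)
    have "(\<Sum>k. p k N) = (\<Sum>k<N. p k N)"
      by (intro suminf_finite) (auto simp: p_def)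
    also have "\<dots> = colored_jones_fig8 N (exp (a / of_nat N))"
      using assms(2) elim by (subst colored_jones_fig8_exp) (auto simp: p_def)
    finally show ?case .
  qed
  ultimately show ?thesis
    using Lim_transform_eventually by force
qed

end
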